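(* Let $(R,\mathbf m)$ be a one-dimensional Noetherian local ring. (1) If $yR$ is a parameter ideal of $R$, then $g(Q) \le g(yR)$ for every parameter ideal $Q$ of $R$ such that $Q \subseteq yR$. (2) There exists a positive integer $n$ such that all parameter ideals of $R$ contained in $\mathbf m^n$ have the same Goto number. Moreover, this number is the minimal Goto number of a parameter ideal of $R$.
   Context: A parameter ideal of a Noetherian local ring $(R,\mathbf m)$ of dimension $d$ is an $\mathbf m$-primary ideal generated by $d$ elements; so in dimension one it is a principal $\mathbf m$-primary ideal. The Goto number $g(Q)$ of a parameter ideal $Q$ is the largest integer $g$ such that $Q :_R \mathbf m^g$ is integral over $Q$, i.e. $Q:\mathbf m^g \subseteq \overline{Q}$, where $\overline{Q}$ is the integral closure of the ideal $Q$. *)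

theory Defs
  imports "HOL-Algebra.Algebra" "HOL-Library.Extended_Nat"
begin

locale noetherian_local_ring = cring R + noetherian_ring R for R (structure) and M +
  assumes maximal: "maximalideal M R"
    and maximal_unique: "maximalideal I R \<Longrightarrow> I = M"

text \<open>
  Supremum of the lengths of chains of prime ideals. A chain
  \<open>P 0 \<subset> \<dots> \<subset> P n\<close> has length \<open>n\<close>. The zero ring, which has no prime ideals,
  gets dimension \<open>0\<close>.
\<close>
definition krull_dim :: "('a, 'b) ring_scheme \<Rightarrow> enat" where
  "krull_dim R =
    (SUP n \<in> {n. \<exists>P :: nat \<Rightarrow> 'a set.
        (\<forall>i\<le>n. primeideal (P i) R) \<and> (\<forall>i<n. P i \<subset> P (Suc i))}. enat n)"

text \<open>The zeroth power of an ideal is \<open>carrier R\<close>, the unit of \<^const>\<open>ideals_set\<close>.\<close>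
abbreviation ideal_power :: "('a, 'b) ring_scheme \<Rightarrow> 'a set \<Rightarrow> nat \<Rightarrow> 'a set" where
  "ideal_power R I n \<equiv> I [^]\<^bsub>ideals_set R\<^esub> n"

definition ideal_radical :: "('a, 'b) ring_scheme \<Rightarrow> 'a set \<Rightarrow> 'a set" where
  "ideal_radical R I = {x \<in> carrier R. \<exists>n :: nat. x [^]\<^bsub>R\<^esub> n \<in> I}"

definition primary_ideal :: "('a, 'b) ring_scheme \<Rightarrow> 'a set \<Rightarrow> bool" where
  "primary_ideal R Q \<longleftrightarrow> ideal Q R \<and> Q \<noteq> carrier R \<and>
    (\<forall>a \<in> carrier R. \<forall>b \<in> carrier R.
        a \<otimes>\<^bsub>R\<^esub> b \<in> Q \<longrightarrow> a \<in> Q \<or> b \<in> ideal_radical R Q)"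

text \<open>
  An \<open>M\<close>-primary ideal that is generated by \<open>d\<close> elements, where \<open>d\<close> is the Krull dimension.
  The generators form a list, so they may be repeated.
\<close>
definition parameter_ideal :: "('a, 'b) ring_scheme \<Rightarrow> 'a set \<Rightarrow> 'a set \<Rightarrow> bool" where
  "parameter_ideal R M Q \<longleftrightarrow> primary_ideal R Q \<and> ideal_radical R Q = M \<and>
    (\<exists>xs. set xs \<subseteq> carrier R \<and> enat (length xs) = krull_dim R \<and> Q = Idl\<^bsub>R\<^esub> (set xs))"

definition ideal_colon :: "('a, 'b) ring_scheme \<Rightarrow> 'a set \<Rightarrow> 'a set \<Rightarrow> 'a set" where
  "ideal_colon R I J = {x \<in> carrier R. \<forall>y \<in> J. x \<otimes>\<^bsub>R\<^esub> y \<in> I}"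

text \<open>
  The elements \<open>x\<close> that satisfy an equation
  \<open>x^n + a 1 * x^(n - 1) + \<dots> + a n = 0\<close> with \<open>n > 0\<close> and \<open>a i \<in> I^i\<close>.
\<close>
definition ideal_integral_closure :: "('a, 'b) ring_scheme \<Rightarrow> 'a set \<Rightarrow> 'a set" where
  "ideal_integral_closure R I = {x \<in> carrier R. \<exists>n > 0. \<exists>a :: nat \<Rightarrow> 'a.
      (\<forall>i \<in> {1..n}. a i \<in> ideal_power R I i) \<and>
      x [^]\<^bsub>R\<^esub> n \<oplus>\<^bsub>R\<^esub> (\<Oplus>\<^bsub>R\<^esub>i \<in> {1..n}. a i \<otimes>\<^bsub>R\<^esub> x [^]\<^bsub>R\<^esub> (n - i)) = \<zero>\<^bsub>R\<^esub>}"

text \<open>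
  For a parameter ideal \<open>Q\<close> of a Noetherian local ring the exponents in question are bounded:
  \<open>M^g \<subseteq> Q\<close> for large \<open>g\<close>, and then the colon ideal is \<open>carrier R\<close>, whereas the integral closure
  of \<open>Q\<close> is contained in \<open>M\<close>. The exponent \<open>0\<close> always qualifies.
\<close>
definition goto_number :: "('a, 'b) ring_scheme \<Rightarrow> 'a set \<Rightarrow> 'a set \<Rightarrow> nat" where
  "goto_number R M Q =
    (GREATEST g. ideal_colon R Q (ideal_power R M g) \<subseteq> ideal_integral_closure R Q)"

end

theory Submission
  imports Defs
begin

text \<open>
  Let \<open>Q = xR\<close> and \<open>x = zy\<close>. If \<open>a M\<^sup>g \<subseteq> yR\<close>, then \<open>(za) M\<^sup>g \<subseteq> Q\<close>, and an integral equation of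
  \<open>za\<close> over \<open>zyR\<close> has the form \<open>z\<^sup>n b = 0\<close>, where \<open>b\<close> is the left-hand side of a possible integral
  equation of \<open>a\<close> over \<open>yR\<close>. As \<open>x\<close> is a multiple of \<open>z\<close> and lies in no minimal prime, \<open>b\<close> is
  nilpotent, and expanding \<open>b\<^sup>k = 0\<close> gives an integral equation of \<open>a\<close>.
  For the second part, let \<open>Q\<^sub>0\<close> be a parameter ideal with minimal Goto number and \<open>M\<^sup>n \<subseteq> Q\<^sub>0\<close>; the
  first part applies to every parameter ideal inside \<open>M\<^sup>n\<close>.
\<close>

no_notation Sum_Type.Plus (infixr \<open><+>\<close> 65)

section \<open>Powers of ideals and principal ideals\<close>

context cring
begin

lemma ideal_prod_subset:
  assumes "ideal K R" "\<And>i j. i \<in> I \<Longrightarrow> j \<in> J \<Longrightarrow> i \<otimes> j \<in> K"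
  shows "I \<cdot> J \<subseteq> K"
proof
  fix s assume "s \<in> I \<cdot> J"
  then show "s \<in> K"
    by induction (auto intro: assms(2) additive_subgroup.a_closed[OF ideal.axioms(1)[OF assms(1)]])
qed

lemma ideal_power_0: "ideal_power R I 0 = carrier R"
  by (simp add: nat_pow_def ideals_set_def)

lemma ideal_power_Suc: "ideal_power R I (Suc n) = ideal_power R I n \<cdot> I"
  by (simp add: nat_pow_def ideals_set_def)

lemma ideal_power_ideal: "ideal I R \<Longrightarrow> ideal (ideal_power R I n) R"
  by (induction n) (simp_all only: ideal_power_0 ideal_power_Suc oneideal ideal_prod_is_ideal)

lemma ideal_power_1: "ideal I R \<Longrightarrow> ideal_power R I 1 = I"
  using ideal_prod_commute[OF oneideal] ideal_prod_one
  unfolding One_nat_def ideal_power_Suc ideal_power_0 by simp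

lemma ideal_power_mult:
  assumes "ideal I R" "a \<in> ideal_power R I i" "b \<in> ideal_power R I j"
  shows "a \<otimes> b \<in> ideal_power R I (i + j)"
proof -
  interpret S: semiring "ideals_set R" by (rule ideals_set_is_semiring)
  have "I \<in> carrier (ideals_set R)" using assms(1) by (simp add: ideals_set_def)
  then have "ideal_power R I (i + j) = ideal_power R I i \<cdot> ideal_power R I j"
    using S.nat_pow_mult[of I i j] by (simp add: ideals_set_def)
  then show ?thesis using assms ideal_prod.prod by metis
qed

lemma ideal_power_Suc_subset:
  assumes "ideal I R"
  shows "ideal_power R I (Suc n) \<subseteq> ideal_power R I n" "ideal_power R I (Suc n) \<subseteq> I"
  using ideal_prod_inter[OF ideal_power_ideal[OF assms, of n] assms] by (auto simp only: ideal_power_Suc)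

lemma ideal_power_antimono:
  assumes "ideal I R" "m \<le> n"
  shows "ideal_power R I n \<subseteq> ideal_power R I m"
  using assms(2) by (rule lift_Suc_antimono_le[rotated]) (rule ideal_power_Suc_subset(1)[OF assms(1)])

lemma cgenideal_memI: "r \<in> carrier R \<Longrightarrow> r \<otimes> a \<in> PIdl a"
  unfolding cgenideal_def by blast

lemma cgenideal_memE:
  assumes "x \<in> PIdl a" obtains r where "r \<in> carrier R" "x = r \<otimes> a"
  using assms unfolding cgenideal_def by blast

lemma ideal_prod_cgenideal:
  assumes "a \<in> carrier R" "b \<in> carrier R"
  shows "(PIdl a) \<cdot> (PIdl b) = PIdl (a \<otimes> b)"
proof
  have "\<exists>t\<in>carrier R. (r \<otimes> a) \<otimes> (s \<otimes> b) = t \<otimes> (a \<otimes> b)" if "r \<in> carrier R" "s \<in> carrier R" for r s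
    using that assms by (intro bexI[of _ "r \<otimes> s"]) (auto simp: m_ac)
  then show "(PIdl a) \<cdot> (PIdl b) \<subseteq> PIdl (a \<otimes> b)"
    by (intro ideal_prod_subset cgenideal_ideal m_closed assms) (metis cgenideal_memE cgenideal_memI)
  show "PIdl (a \<otimes> b) \<subseteq> (PIdl a) \<cdot> (PIdl b)"
    by (intro cgenideal_minimal ideal_prod_is_ideal cgenideal_ideal assms ideal_prod.prod cgenideal_self)
qed

lemma ideal_power_cgenideal:
  assumes "y \<in> carrier R"
  shows "ideal_power R (PIdl y) n = PIdl (y [^] n)"
proof (induction n)
  case 0
  show ?case unfolding ideal_power_0 using genideal_one cgenideal_eq_genideal[OF one_closed] by simp
next
  case (Suc n)
  then show ?case unfolding ideal_power_Suc using assms by (simp add: ideal_prod_cgenideal)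
qed

end

section \<open>Monic values and the integral closure of an ideal\<close>

text \<open>
  The values at \<open>x\<close> of the monic polynomials of degree \<open>n\<close> whose coefficient of degree \<open>n - i\<close>
  lies in \<open>I\<^sup>i\<close>, built up by Horner's scheme.
\<close>
primrec monic_values :: "('a, 'b) ring_scheme \<Rightarrow> 'a set \<Rightarrow> 'a \<Rightarrow> nat \<Rightarrow> 'a set" where
  "monic_values R I x 0 = {\<one>\<^bsub>R\<^esub>}"
| "monic_values R I x (Suc n) =
    {x \<otimes>\<^bsub>R\<^esub> p \<oplus>\<^bsub>R\<^esub> c | p c. p \<in> monic_values R I x n \<and> c \<in> ideal_power R I (Suc n)}"

context cring
begin

lemma monic_values_SucI:
  "p \<in> monic_values R I x n \<Longrightarrow> c \<in> ideal_power R I (Suc n) \<Longrightarrow>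
    x \<otimes> p \<oplus> c \<in> monic_values R I x (Suc n)"
  by auto

lemma monic_values_SucE:
  assumes "q \<in> monic_values R I x (Suc n)"
  obtains p c where "p \<in> monic_values R I x n" "c \<in> ideal_power R I (Suc n)" "q = x \<otimes> p \<oplus> c"
  using assms by auto

declare monic_values.simps(2) [simp del]

lemma monic_values_carrier:
  assumes "ideal I R" "x \<in> carrier R"
  shows "p \<in> monic_values R I x n \<Longrightarrow> p \<in> carrier R"
proof (induction n arbitrary: p)
  case (Suc n)
  then show ?case
    using ideal.Icarr[OF ideal_power_ideal[OF assms(1)]] assms(2) by (auto elim!: monic_values_SucE)
qed simp

text \<open>The leading coefficient of \<open>q\<close> becomes \<open>c\<close> at degree
  \<open>m = (m + j) - j\<close>, where a coefficient from the \<open>j\<close>-th power of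
  \<open>I\<close> is allowed; lower coefficients gain weight \<open>j\<close> in the same way.
  Since \<open>0 < j\<close>, the leading coefficient of \<open>p\<close> is untouched.\<close>

lemma monic_values_add:
  assumes "ideal I R" "x \<in> carrier R" "0 < j" "c \<in> ideal_power R I j"
  shows "p \<in> monic_values R I x (m + j) \<Longrightarrow> q \<in> monic_values R I x m \<Longrightarrow>
    p \<oplus> c \<otimes> q \<in> monic_values R I x (m + j)"
proof (induction m arbitrary: p q)
  case 0
  \<comment> \<open>Here \<open>q\<close> is \<open>\<one>\<close>, so \<open>c\<close> is absorbed
    by the constant term of \<open>p\<close>; that term exists because \<open>j\<close> is
    positive.\<close>
  obtain j' where j: "j = Suc j'" using assms(3) gr0_implies_Suc by blast
  obtain p' d where p: "p' \<in> monic_values R I x j'" "d \<in> ideal_power R I j" "p = x \<otimes> p' \<oplus> d"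
    using 0(1) j by (auto elim: monic_values_SucE)
  have carr: "p' \<in> carrier R" "d \<in> carrier R" "c \<in> carrier R"
    using p assms monic_values_carrier ideal.Icarr ideal_power_ideal by metis+
  have "p \<oplus> c \<otimes> q = x \<otimes> p' \<oplus> (d \<oplus> c)" using 0 p carr assms by (simp add: a_assoc)
  moreover have "d \<oplus> c \<in> ideal_power R I j"
    using p assms additive_subgroup.a_closed[OF ideal.axioms(1)[OF ideal_power_ideal]] by blast
  ultimately show ?case using p(1) monic_values_SucI by (simp add: j)
next
  case (Suc m)
  obtain p' d where p: "p' \<in> monic_values R I x (m + j)" "d \<in> ideal_power R I (Suc (m + j))" "p = x \<otimes> p' \<oplus> d"
    using Suc.prems(1) by (auto elim: monic_values_SucE)
  obtain q' e where q: "q' \<in> monic_values R I x m" "e \<in> ideal_power R I (Suc m)" "q = x \<otimes> q' \<oplus> e"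
    using Suc.prems(2) by (auto elim: monic_values_SucE)
  have carr: "p' \<in> carrier R" "q' \<in> carrier R" "d \<in> carrier R" "c \<in> carrier R" "e \<in> carrier R"
    using p q assms monic_values_carrier ideal.Icarr ideal_power_ideal by metis+
  have "p \<oplus> c \<otimes> q = x \<otimes> (p' \<oplus> c \<otimes> q') \<oplus> (d \<oplus> c \<otimes> e)"
    unfolding p q using carr assms(2) by algebra
  moreover have "c \<otimes> e \<in> ideal_power R I (Suc (m + j))"
    using ideal_power_mult[OF assms(1,4) q(2)] by (simp add: add.commute)
  then have "d \<oplus> c \<otimes> e \<in> ideal_power R I (Suc (m + j))"
    using p assms additive_subgroup.a_closed[OF ideal.axioms(1)[OF ideal_power_ideal]] by blast
  ultimately show ?case using Suc.IH[OF p(1) q(1)] monic_values_SucI by simp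
qed

text \<open>Along Horner's scheme for \<open>p\<close>, a factor
  \<open>x \<otimes> p' \<oplus> d\<close> times \<open>q\<close> splits into
  \<open>x \<otimes> (p' \<otimes> q)\<close>, which is again monic, and
  \<open>d \<otimes> q\<close>, which \<open>monic_values_add\<close> absorbs.\<close>

lemma monic_values_mult:
  assumes "ideal I R" "x \<in> carrier R" "q \<in> monic_values R I x m"
  shows "p \<in> monic_values R I x n \<Longrightarrow> p \<otimes> q \<in> monic_values R I x (n + m)"
proof (induction n arbitrary: p)
  case 0
  then show ?case using assms monic_values_carrier by simp
next
  case (Suc n)
  obtain p' d where p: "p' \<in> monic_values R I x n" "d \<in> ideal_power R I (Suc n)" "p = x \<otimes> p' \<oplus> d"
    using Suc.prems by (auto elim: monic_values_SucE)
  have carr: "p' \<in> carrier R" "q \<in> carrier R" "d \<in> carrier R"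
    using p assms monic_values_carrier ideal.Icarr ideal_power_ideal by metis+
  \<comment> \<open>Multiplication by \<open>x\<close> alone is a Horner step with last coefficient
    \<open>\<zero>\<close>.\<close>
  have "\<zero> \<in> ideal_power R I (Suc (n + m))"
    using assms additive_subgroup.zero_closed[OF ideal.axioms(1)[OF ideal_power_ideal]] by blast
  from monic_values_SucI[OF Suc.IH[OF p(1)] this]
  have "x \<otimes> (p' \<otimes> q) \<in> monic_values R I x (m + Suc n)"
    using carr assms(2) by (simp add: add.commute)
  from monic_values_add[OF assms(1,2) _ p(2) this assms(3)]
  have "x \<otimes> (p' \<otimes> q) \<oplus> d \<otimes> q \<in> monic_values R I x (m + Suc n)" by simp
  moreover have "p \<otimes> q = x \<otimes> (p' \<otimes> q) \<oplus> d \<otimes> q"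
    unfolding p using carr assms(2) by algebra
  ultimately show ?case by (simp add: add.commute)
qed

lemma monic_values_pow:
  assumes "ideal I R" "x \<in> carrier R" "p \<in> monic_values R I x n"
  shows "p [^] k \<in> monic_values R I x (k * n)"
  by (induction k) (use assms monic_values_mult in \<open>simp_all add: add.commute\<close>)

text \<open>Links Horner's scheme to the explicit sum in \<open>ideal_integral_closure\<close>, so
  that later arguments can use induction on the degree instead of manipulating sums.\<close>

lemma monic_values_iff:
  assumes "ideal I R" "x \<in> carrier R"
  shows "p \<in> monic_values R I x n \<longleftrightarrow> (\<exists>a. (\<forall>i \<in> {1..n}. a i \<in> ideal_power R I i) \<and>
    p = x [^] n \<oplus> (\<Oplus>i \<in> {1..n}. a i \<otimes> x [^] (n - i)))"
proof (induction n arbitrary: p)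
  case 0
  show ?case by auto
next
  case (Suc n)
  let ?s = "\<lambda>a n. x [^] n \<oplus> (\<Oplus>i \<in> {1..n}. a i \<otimes> x [^] (n - i))"
  \<comment> \<open>The old summands each gain one factor \<open>x\<close>; the new index
    \<open>Suc n\<close> contributes the constant term, since its power of \<open>x\<close> has
    exponent \<open>0\<close>.\<close>
  have step: "?s a (Suc n) = x \<otimes> ?s a n \<oplus> a (Suc n)"
    if "\<forall>i \<in> {1..Suc n}. a i \<in> ideal_power R I i" for a
  proof -
    have carr: "a i \<in> carrier R" if "i \<in> {1..Suc n}" for i
      using that \<open>\<forall>i \<in> {1..Suc n}. a i \<in> _\<close> ideal.Icarr ideal_power_ideal assms(1) by metis
    have "(\<Oplus>i \<in> {1..Suc n}. a i \<otimes> x [^] (Suc n - i)) =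
      a (Suc n) \<otimes> x [^] (Suc n - Suc n) \<oplus> (\<Oplus>i \<in> {1..n}. a i \<otimes> x [^] (Suc n - i))"
    proof -
      have "{1..Suc n} = insert (Suc n) {1..n}" by auto
      then show ?thesis
        by (simp only:) (intro finsum_insert; use carr assms(2) in auto)
    qed
    also have "(\<Oplus>i \<in> {1..n}. a i \<otimes> x [^] (Suc n - i)) = (\<Oplus>i \<in> {1..n}. x \<otimes> (a i \<otimes> x [^] (n - i)))"
      by (intro finsum_cong') (use carr assms(2) in \<open>auto simp: Suc_diff_le m_ac\<close>)
    also have "\<dots> = x \<otimes> (\<Oplus>i \<in> {1..n}. a i \<otimes> x [^] (n - i))"
      by (intro finsum_rdistr[symmetric]) (use carr assms(2) in auto)
    finally have eq: "(\<Oplus>i \<in> {1..Suc n}. a i \<otimes> x [^] (Suc n - i)) =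
      a (Suc n) \<oplus> x \<otimes> (\<Oplus>i \<in> {1..n}. a i \<otimes> x [^] (n - i))"
      using carr[of "Suc n"] by simp
    have "(\<Oplus>i \<in> {1..n}. a i \<otimes> x [^] (n - i)) \<in> carrier R"
      by (intro finsum_closed) (use carr assms(2) in auto)
    with carr[of "Suc n"] assms(2) show ?thesis
      unfolding eq by (simp add: r_distr a_ac m_comm)
  qed
  show ?case
  proof
    assume "p \<in> monic_values R I x (Suc n)"
    then obtain q c where q: "q \<in> monic_values R I x n" "c \<in> ideal_power R I (Suc n)" "p = x \<otimes> q \<oplus> c"
      by (rule monic_values_SucE)
    obtain a where a: "\<forall>i \<in> {1..n}. a i \<in> ideal_power R I i" "q = ?s a n"
      using Suc.IH[of q] q(1) by auto
    have carr: "a i \<in> carrier R" if "i \<in> {1..n}" for i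
      using that a(1) ideal.Icarr ideal_power_ideal assms(1) by metis
    let ?a = "a(Suc n := c)"
    have mem: "\<forall>i \<in> {1..Suc n}. ?a i \<in> ideal_power R I i" using a(1) q(2) by auto
    have "(\<Oplus>i \<in> {1..n}. ?a i \<otimes> x [^] (n - i)) = (\<Oplus>i \<in> {1..n}. a i \<otimes> x [^] (n - i))"
      by (intro finsum_cong') (use carr assms(2) in auto)
    then have "p = ?s ?a (Suc n)" unfolding step[OF mem] q a(2) by simp
    with mem show "\<exists>a. (\<forall>i \<in> {1..Suc n}. a i \<in> ideal_power R I i) \<and> p = ?s a (Suc n)" by blast
  next
    assume "\<exists>a. (\<forall>i \<in> {1..Suc n}. a i \<in> ideal_power R I i) \<and> p = ?s a (Suc n)"
    then obtain a where a: "\<forall>i \<in> {1..Suc n}. a i \<in> ideal_power R I i" "p = ?s a (Suc n)" by blast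
    have "?s a n \<in> monic_values R I x n"
      unfolding Suc.IH using a(1) by (intro exI[of _ a]) auto
    then show "p \<in> monic_values R I x (Suc n)"
      unfolding a(2) step[OF a(1)] using a(1) by (intro monic_values_SucI bspec[OF a(1)]) simp_all
  qed
qed

lemma integral_closure_iff:
  assumes "ideal I R" "x \<in> carrier R"
  shows "x \<in> ideal_integral_closure R I \<longleftrightarrow> (\<exists>n > 0. \<zero> \<in> monic_values R I x n)"
  unfolding ideal_integral_closure_def monic_values_iff[OF assms]
  using assms(2) by (simp add: eq_commute[of \<zero>])

text \<open>A power of a monic value is a monic value of larger degree, so a vanishing power of
  \<open>b\<close> is itself an integral equation of \<open>x\<close>.\<close>

lemma integral_closureI_nilpotent:
  assumes "ideal I R" "x \<in> carrier R" "0 < n" "b \<in> monic_values R I x n" "b [^] (k :: nat) = \<zero>"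
  shows "x \<in> ideal_integral_closure R I"
proof -
  have "b \<in> carrier R" using assms monic_values_carrier by blast
  \<comment> \<open>Nothing excludes \<open>k = 0\<close>, while an integral equation needs positive
    degree; raising the exponent to \<open>Suc k\<close> guarantees it.\<close>
  then have "b [^] Suc k = \<zero>" using assms(5) by simp
  then show ?thesis
    using monic_values_pow[OF assms(1,2,4), of "Suc k"] assms(3) integral_closure_iff[OF assms(1,2)]
    by (metis nat_0_less_mult_iff zero_less_Suc)
qed

text \<open>The integral equation is \<open>x - x = 0\<close>, of degree one with coefficient
  \<open>\<ominus> x\<close>.\<close>

lemma subset_integral_closure:
  assumes "ideal I R"
  shows "I \<subseteq> ideal_integral_closure R I"
proof
  fix x assume x: "x \<in> I"
  then have carr: "x \<in> carrier R" using assms ideal.Icarr by metis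
  have "\<ominus> x \<in> ideal_power R I (Suc 0)"
    using ideal_power_1[OF assms] x additive_subgroup.a_inv_closed[OF ideal.axioms(1)[OF assms]] by simp
  from monic_values_SucI[OF _ this, of \<one> x]
  have "\<zero> \<in> monic_values R I x (Suc 0)" using carr by (simp add: r_neg)
  then show "x \<in> ideal_integral_closure R I" using integral_closure_iff[OF assms carr] by blast
qed

text \<open>All coefficients except the leading one lie in \<open>I\<close>, so every monic value at
  \<open>\<one>\<close> is \<open>\<one>\<close> plus an element of \<open>I\<close>; if it
  vanishes, \<open>I\<close> contains \<open>\<one>\<close>. This is what bounds the exponents in
  the Goto number.\<close>

lemma one_in_integral_closure:
  assumes "ideal I R" "\<one> \<in> ideal_integral_closure R I"
  shows "I = carrier R"
proof -
  have *: "\<exists>c\<in>I. q = \<one> \<oplus> c" if "q \<in> monic_values R I \<one> n" for n q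
    using that
  proof (induction n arbitrary: q)
    case 0
    then show ?case using additive_subgroup.zero_closed[OF ideal.axioms(1)[OF assms(1)]]
      by (auto intro!: bexI[of _ \<zero>])
  next
    case (Suc n)
    from Suc.prems obtain p d where p: "p \<in> monic_values R I \<one> n"
      "d \<in> ideal_power R I (Suc n)" "q = \<one> \<otimes> p \<oplus> d"
      by (rule monic_values_SucE)
    obtain c where c: "c \<in> I" "p = \<one> \<oplus> c" using Suc.IH p(1) by blast
    have "d \<in> I" using p(2) ideal_power_Suc_subset(2)[OF assms(1)] by blast
    then have "c \<oplus> d \<in> I" "c \<in> carrier R" "d \<in> carrier R"
      using c(1) additive_subgroup.a_closed[OF ideal.axioms(1)[OF assms(1)]] ideal.Icarr[OF assms(1)] by auto
    then show ?case using p(3) c(2) by (auto intro!: bexI[of _ "c \<oplus> d"] simp: a_assoc)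
  qed
  obtain n where "\<zero> \<in> monic_values R I \<one> n"
    using assms integral_closure_iff[OF assms(1) one_closed] by blast
  then obtain c where c: "c \<in> I" "\<zero> = \<one> \<oplus> c" using * by blast
  have "c \<in> carrier R" using c(1) ideal.Icarr[OF assms(1)] by blast
  then have "\<one> = \<ominus> c" using c(2) minus_equality[of \<one> c] by simp
  then have "\<one> \<in> I" using c(1) additive_subgroup.a_inv_closed[OF ideal.axioms(1)[OF assms(1)]] by metis
  then show ?thesis by (rule ideal.one_imp_carrier[OF assms(1)])
qed

text \<open>A coefficient of weight \<open>i\<close> is a multiple of \<open>(z y)^i\<close> and
  comes with \<open>(z a)^(n - i)\<close>, so every summand carries the factor \<open>z^n\<close>.
  Dividing it out formally leaves a monic value at \<open>a\<close> over
  \<open>PIdl y\<close>.\<close>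

lemma monic_values_scale:
  assumes "y \<in> carrier R" "z \<in> carrier R" "a \<in> carrier R"
  shows "q \<in> monic_values R (PIdl (z \<otimes> y)) (z \<otimes> a) n \<Longrightarrow>
    \<exists>b \<in> monic_values R (PIdl y) a n. q = z [^] n \<otimes> b"
proof (induction n arbitrary: q)
  case 0
  then show ?case by simp
next
  case (Suc n)
  from Suc.prems obtain p d where p: "p \<in> monic_values R (PIdl (z \<otimes> y)) (z \<otimes> a) n"
    "d \<in> ideal_power R (PIdl (z \<otimes> y)) (Suc n)" "q = (z \<otimes> a) \<otimes> p \<oplus> d"
    by (rule monic_values_SucE)
  obtain b where b: "b \<in> monic_values R (PIdl y) a n" "p = z [^] n \<otimes> b" using Suc.IH p(1) by blast
  then have bc: "b \<in> carrier R" using monic_values_carrier cgenideal_ideal assms by blast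
  obtain r where r: "r \<in> carrier R" "d = r \<otimes> (z \<otimes> y) [^] Suc n"
    using p(2) assms(1,2) unfolding ideal_power_cgenideal[OF m_closed[OF assms(2,1)]]
    by (blast elim: cgenideal_memE)
  have d: "d = z [^] Suc n \<otimes> (r \<otimes> y [^] Suc n)"
    unfolding r nat_pow_distrib[OF assms(2,1)] using r(1) assms by (simp only: m_ac nat_pow_closed m_closed)
  have "r \<otimes> y [^] Suc n \<in> ideal_power R (PIdl y) (Suc n)"
    unfolding ideal_power_cgenideal[OF assms(1)] using r(1) by (rule cgenideal_memI)
  from monic_values_SucI[OF b(1) this]
  have mem: "a \<otimes> b \<oplus> r \<otimes> y [^] Suc n \<in> monic_values R (PIdl y) a (Suc n)" .
  have "r \<otimes> y [^] Suc n \<in> carrier R" using r assms by simp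
  then have "q = z [^] Suc n \<otimes> (a \<otimes> b \<oplus> r \<otimes> y [^] Suc n)"
    unfolding p(3) d b(2) using assms bc
    by (simp add: r_distr m_ac)
  with mem show ?case by blast
qed

end

section \<open>Products of prime ideals in Noetherian rings\<close>

text \<open>Zorn's lemma applies because the union of a nonempty chain of ideals is a member of the
  chain.\<close>

lemma (in noetherian_ring) exists_maximal_in_ideal_family:
  assumes "S \<subseteq> {I. ideal I R}" "S \<noteq> {}"
  obtains J where "J \<in> S" "\<And>K. K \<in> S \<Longrightarrow> J \<subseteq> K \<Longrightarrow> K = J"
proof -
  have "\<exists>J\<in>S. \<forall>K\<in>S. J \<subseteq> K \<longrightarrow> K = J"
  proof (rule subset_Zorn_nonempty)
    fix C assume C: "C \<noteq> {}" "subset.chain S C"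
    then have "subset.chain {I. ideal I R} C" using assms(1) by (auto simp: subset.chain_def)
    then have "\<Union>C \<in> C" using C(1) ideal_chain_is_trivial by blast
    then show "\<Union>C \<in> S" using C(2) by (auto simp: subset.chain_def)
  qed (rule assms(2))
  then show ?thesis using that by blast
qed

context cring
begin

abbreviation ideals_product :: "'a set list \<Rightarrow> 'a set" where
  "ideals_product Is \<equiv> foldr (ideal_prod R) Is (carrier R)"

lemma ideals_product_ideal:
  "\<forall>I\<in>set Is. ideal I R \<Longrightarrow> ideal (ideals_product Is) R"
  by (induction Is) (simp_all add: oneideal ideal_prod_is_ideal)

lemma ideals_product_append:
  assumes "\<forall>I\<in>set Is. ideal I R" "\<forall>J\<in>set Js. ideal J R"
  shows "ideals_product (Is @ Js) = (ideals_product Is) \<cdot> (ideals_product Js)"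
  using assms(1)
proof (induction Is)
  case Nil
  then show ?case
    using ideal_prod_one[of "ideals_product Js"] ideal_prod_commute[OF oneideal, of "ideals_product Js"]
      ideals_product_ideal[OF assms(2)] by simp
next
  case (Cons I Is)
  then show ?case
    using ideal_prod_assoc[of I "ideals_product Is" "ideals_product Js"]
      ideals_product_ideal[of Is] ideals_product_ideal[OF assms(2)] by simp
qed

text \<open>On expanding a product of two elements, each term has a factor in \<open>I\<close> or is
  a multiple of \<open>a \<otimes> b\<close>.\<close>

lemma ideal_prod_add_cgenideal_subset:
  assumes "ideal I R" "a \<in> carrier R" "b \<in> carrier R" "a \<otimes> b \<in> I"
  shows "(I <+> PIdl a) \<cdot> (I <+> PIdl b) \<subseteq> I"
proof (rule ideal_prod_subset[OF assms(1)])
  fix u v assume "u \<in> I <+> PIdl a" "v \<in> I <+> PIdl b"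
  then obtain i r j s where u: "i \<in> I" "r \<in> carrier R" "u = i \<oplus> r \<otimes> a"
    and v: "j \<in> I" "s \<in> carrier R" "v = j \<oplus> s \<otimes> b"
    unfolding set_add_def' cgenideal_def by blast
  have carr: "i \<in> carrier R" "j \<in> carrier R" using u v ideal.Icarr[OF assms(1)] by auto
  have "u \<otimes> v = v \<otimes> i \<oplus> (r \<otimes> a \<otimes> j \<oplus> r \<otimes> s \<otimes> (a \<otimes> b))"
    unfolding u v using carr u v assms by algebra
  moreover have "v \<otimes> i \<in> I" "r \<otimes> a \<otimes> j \<in> I" "r \<otimes> s \<otimes> (a \<otimes> b) \<in> I"
    using carr u v assms by (auto intro!: ideal.I_l_closed[OF assms(1)])
  ultimately show "u \<otimes> v \<in> I"
    by (auto intro!: additive_subgroup.a_closed[OF ideal.axioms(1)[OF assms(1)]])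
qed

lemma subset_ideal_add:
  assumes "ideal I R" "ideal J R"
  shows "I \<subseteq> I <+> J" "J \<subseteq> I <+> J"
  using genideal_self[of "I \<union> J"] union_genideal[OF assms]
    ideal.Icarr[OF assms(1)] ideal.Icarr[OF assms(2)] by auto

text \<open>Noetherian induction: a maximal counterexample \<open>J\<close> is proper and not prime,
  so \<open>a \<otimes> b \<in> J\<close> for some \<open>a\<close> and \<open>b\<close> outside
  \<open>J\<close>. The strictly larger ideals \<open>J <+> PIdl a\<close> and
  \<open>J <+> PIdl b\<close> contain products of primes, and concatenating the two lists gives a
  product inside \<open>J\<close>.\<close>

lemma ideal_contains_prime_product:
  assumes "noetherian_ring R" "ideal I R"
  shows "\<exists>Ps. (\<forall>P\<in>set Ps. primeideal P R \<and> I \<subseteq> P) \<and> ideals_product Ps \<subseteq> I"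
proof (rule ccontr)
  define good where "good I \<longleftrightarrow> (\<exists>Ps. (\<forall>P\<in>set Ps. primeideal P R \<and> I \<subseteq> P) \<and> ideals_product Ps \<subseteq> I)" for I
  assume "\<not> ?thesis"
  then have "{I. ideal I R \<and> \<not> good I} \<noteq> {}" using assms(2) by (auto simp: good_def)
  then obtain J where J: "ideal J R" "\<not> good J"
    and max: "\<And>K. ideal K R \<Longrightarrow> \<not> good K \<Longrightarrow> J \<subseteq> K \<Longrightarrow> K = J"
    by (rule noetherian_ring.exists_maximal_in_ideal_family[OF assms(1), of "{I. ideal I R \<and> \<not> good I}", rotated])
      auto
  \<comment> \<open>The empty list witnesses the claim for \<open>carrier R\<close>.\<close>
  have "J \<noteq> carrier R" using J(2) unfolding good_def by (metis emptyE foldr_Nil id_apply list.set(1) order_refl)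
  moreover have "\<not> primeideal J R"
  proof
    assume "primeideal J R"
    then have "good J" unfolding good_def using ideal_prod_one[OF J(1)] by (intro exI[of _ "[J]"]) simp
    with J(2) show False by simp
  qed
  ultimately obtain a b where ab: "a \<in> carrier R" "b \<in> carrier R" "a \<otimes> b \<in> J" "a \<notin> J" "b \<notin> J"
    using primeidealI[OF J(1) is_cring] by blast
  have ex: "\<exists>Ps. (\<forall>P\<in>set Ps. primeideal P R \<and> J \<subseteq> P) \<and> ideals_product Ps \<subseteq> J <+> PIdl c"
    if c: "c \<in> carrier R" "c \<notin> J" for c
  proof -
    note id = cgenideal_ideal[OF c(1)]
    have "good (J <+> PIdl c)"
      using max[OF add_ideals[OF J(1) id]] subset_ideal_add[OF J(1) id] cgenideal_self[OF c(1)] c(2)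
      by blast
    then show ?thesis unfolding good_def using subset_ideal_add(1)[OF J(1) id] by blast
  qed
  obtain Ps where Ps: "\<forall>P\<in>set Ps. primeideal P R \<and> J \<subseteq> P" "ideals_product Ps \<subseteq> J <+> PIdl a"
    using ex ab by blast
  obtain Qs where Qs: "\<forall>P\<in>set Qs. primeideal P R \<and> J \<subseteq> P" "ideals_product Qs \<subseteq> J <+> PIdl b"
    using ex ab by blast
  have "(ideals_product Ps) \<cdot> (ideals_product Qs) \<subseteq> J"
  proof (rule ideal_prod_subset[OF J(1)])
    fix u v assume "u \<in> ideals_product Ps" "v \<in> ideals_product Qs"
    then have "u \<otimes> v \<in> (J <+> PIdl a) \<cdot> (J <+> PIdl b)"
      using Ps(2) Qs(2) by (intro ideal_prod.prod) auto
    then show "u \<otimes> v \<in> J" using ideal_prod_add_cgenideal_subset[OF J(1) ab(1-3)] by blast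
  qed
  then have "ideals_product (Ps @ Qs) \<subseteq> J"
    using ideals_product_append[of Ps Qs] Ps(1) Qs(1) primeideal.axioms(1)[of _ R]
    by (simp del: foldr_append)
  then have "good J" unfolding good_def using Ps(1) Qs(1) by (intro exI[of _ "Ps @ Qs"]) auto
  with J(2) show False by simp
qed

lemma primeideal_contains_factor:
  assumes "primeideal P R"
  shows "\<forall>I\<in>set Is. ideal I R \<Longrightarrow> ideals_product Is \<subseteq> P \<Longrightarrow> \<exists>I\<in>set Is. I \<subseteq> P"
proof (induction Is)
  case Nil
  then show ?case
    using primeideal.I_notcarr[OF assms] ideal.Icarr[OF primeideal.axioms(1)[OF assms]] by auto
next
  case (Cons I Is)
  then show ?case
    using primeideal_divides_ideal_prod[OF assms, of I "ideals_product Is"] ideals_product_ideal[of Is] by auto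
qed

section \<open>Prime avoidance\<close>

text \<open>Choose an element outside \<open>P\<close> in each ideal; the product lies in all the
  ideals and, by primeness, outside \<open>P\<close>.\<close>

lemma exists_in_ideals_notin_prime:
  assumes "primeideal P R" "finite F" "\<forall>I\<in>F. ideal I R \<and> \<not> I \<subseteq> P"
  shows "\<exists>x\<in>carrier R. (\<forall>I\<in>F. x \<in> I) \<and> x \<notin> P"
  using assms(2,3)
proof (induction F)
  case empty
  then show ?case
    using primeideal.I_notcarr[OF assms(1)] ideal.Icarr[OF primeideal.axioms(1)[OF assms(1)]] by auto
next
  case (insert J F)
  obtain x where x: "x \<in> carrier R" "\<forall>I\<in>F. x \<in> I" "x \<notin> P" using insert by auto
  obtain y where y: "y \<in> J" "y \<notin> P" "ideal J R" using insert.prems by auto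
  have yc: "y \<in> carrier R" using y ideal.Icarr by metis
  have "x \<otimes> y \<notin> P" using primeideal.I_prime[OF assms(1) x(1) yc] x y by blast
  moreover have "\<forall>I\<in>insert J F. x \<otimes> y \<in> I"
    using x y yc insert.prems by (auto intro: ideal.I_l_closed ideal.I_r_closed)
  ultimately show ?case using x yc by blast
qed

text \<open>If \<open>x\<close> avoids the earlier primes but lies in the new prime
  \<open>P\<close>, it is corrected by some \<open>w\<close> in \<open>M\<close> and in all earlier
  primes but not in \<open>P\<close>. Such a \<open>w\<close> exists because no earlier prime is
  contained in \<open>P\<close>.\<close>

lemma prime_avoidance_incomparable:
  assumes "ideal M R" "finite F" "\<forall>P\<in>F. primeideal P R \<and> \<not> M \<subseteq> P"
    and "\<forall>P\<in>F. \<forall>Q\<in>F. P \<subseteq> Q \<longrightarrow> P = Q"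
  shows "\<exists>x\<in>M. \<forall>P\<in>F. x \<notin> P"
  using assms(2-)
proof (induction F)
  case empty
  then show ?case using additive_subgroup.zero_closed[OF ideal.axioms(1)[OF assms(1)]] by blast
next
  case (insert P F)
  obtain x where x: "x \<in> M" "\<forall>Q\<in>F. x \<notin> Q" using insert by auto
  show ?case
  proof (cases "x \<in> P")
    case True
    have "\<forall>I\<in>insert M F. ideal I R \<and> \<not> I \<subseteq> P"
      using insert.prems insert.hyps(2) assms(1) primeideal.axioms(1) by blast
    then obtain w where w: "w \<in> carrier R" "\<forall>I\<in>insert M F. w \<in> I" "w \<notin> P"
      using exists_in_ideals_notin_prime[of P "insert M F"] insert.prems insert.hyps(1) by auto
    have xc: "x \<in> carrier R" using x ideal.Icarr[OF assms(1)] by blast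
    \<comment> \<open>An ideal containing \<open>x \<oplus> w\<close> contains both summands or
      neither, whereas \<open>P\<close> and each earlier prime contain exactly one.\<close>
    have *: "x \<in> I \<longleftrightarrow> w \<in> I" if "ideal I R" "x \<oplus> w \<in> I" for I
    proof -
      interpret ideal I R by fact
      have "x = (x \<oplus> w) \<ominus> w" "w = (x \<oplus> w) \<ominus> x" using xc w(1) by algebra+
      then show ?thesis using that(2) a_inv_closed a_closed unfolding minus_eq by metis
    qed
    have "x \<oplus> w \<notin> P" using *[of P] True w(3) insert.prems(1) primeideal.axioms(1) by blast
    moreover have "x \<oplus> w \<notin> Q" if "Q \<in> F" for Q
      using *[of Q] x(2) w(2) insert.prems(1) primeideal.axioms(1)[of Q R] that by auto
    moreover have "x \<oplus> w \<in> M"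
      using w(2) by (intro additive_subgroup.a_closed[OF ideal.axioms(1)[OF assms(1)] x(1)]) simp
    ultimately show ?thesis by auto
  qed (use x in blast)
qed

section \<open>Radicals of ideals\<close>

lemma ideal_radicalI: "x \<in> carrier R \<Longrightarrow> x [^] (n :: nat) \<in> I \<Longrightarrow> x \<in> ideal_radical R I"
  unfolding ideal_radical_def by blast

lemma ideal_radicalE:
  assumes "x \<in> ideal_radical R I"
  obtains n :: nat where "x \<in> carrier R" "x [^] n \<in> I"
  using assms unfolding ideal_radical_def by blast

lemma ideal_radical_subset_prime:
  assumes "primeideal P R" "I \<subseteq> P"
  shows "ideal_radical R I \<subseteq> P"
proof
  fix x assume "x \<in> ideal_radical R I"
  then obtain n :: nat where x: "x \<in> carrier R" "x [^] n \<in> P" using assms(2) by (blast elim: ideal_radicalE)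
  then show "x \<in> P"
  proof (induction n)
    case 0
    then show ?case
      using primeideal.I_notcarr[OF assms(1)] ideal.one_imp_carrier[OF primeideal.axioms(1)[OF assms(1)]] by auto
  next
    case (Suc n)
    then show ?case using primeideal.I_prime[OF assms(1), of "x [^] n" x] by auto
  qed
qed

lemma pow_in_ideal_power:
  assumes "ideal I R" "x \<in> I"
  shows "x [^] (n :: nat) \<in> ideal_power R I n"
proof (induction n)
  case 0
  then show ?case by (simp only: ideal_power_0 nat_pow_0 one_closed)
next
  case (Suc n)
  then show ?case using assms by (simp only: ideal_power_Suc nat_pow_Suc ideal_prod.prod)
qed

end

section \<open>Chains of primes in dimension one\<close>

lemma prime_chain_le_krull_dim:
  assumes "\<forall>i\<le>n. primeideal (P i) R" "\<forall>i<n. P i \<subset> P (Suc i)"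
  shows "enat n \<le> krull_dim R"
  unfolding krull_dim_def using assms by (intro SUP_upper) blast

lemma no_prime_chain_2:
  assumes "krull_dim R = 1" "primeideal P R" "primeideal Q R" "primeideal N R" "P \<subset> Q" "Q \<subset> N"
  shows False
proof -
  have "enat 2 \<le> krull_dim R"
    using assms by (intro prime_chain_le_krull_dim[where P = "\<lambda>i. if i = 0 then P else if i = 1 then Q else N"])
      (auto simp: less_Suc_eq numeral_2_eq_2)
  then show False using assms(1) by (simp add: one_enat_def)
qed

lemma exists_prime_chain_1:
  assumes "krull_dim R = 1"
  obtains P Q where "primeideal P R" "primeideal Q R" "P \<subset> Q"
proof (rule ccontr)
  assume "\<not> thesis"
  with that have *: "\<not> P \<subset> Q" if "primeideal P R" "primeideal Q R" for P Q using \<open>primeideal P R\<close> \<open>primeideal Q R\<close> by blast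
  have "n = 0" if "\<forall>i\<le>n. primeideal (P i) R" "\<forall>i<n. P i \<subset> P (Suc i)" for n :: nat and P
    using that *[of "P 0" "P 1"] by (cases n) auto
  then have "krull_dim R \<le> enat 0"
    unfolding krull_dim_def by (intro SUP_least) auto
  then show False using assms by (simp add: one_enat_def)
qed

section \<open>Ideals of a Noetherian local ring\<close>

context noetherian_local_ring
begin

lemma M_ideal: "ideal M R"
  using maximal by (rule maximalideal.axioms(1))

lemma M_prime: "primeideal M R"
  using maximal by (rule maximalideal_prime)

text \<open>A maximal element among the proper ideals containing \<open>I\<close> is a maximal
  ideal, hence equal to \<open>M\<close>.\<close>

lemma proper_ideal_subset_M:
  assumes "ideal I R" "I \<noteq> carrier R"
  shows "I \<subseteq> M"
proof -
  let ?S = "{J. ideal J R \<and> J \<noteq> carrier R \<and> I \<subseteq> J}"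
  obtain J where J: "J \<in> ?S" "\<And>K. K \<in> ?S \<Longrightarrow> J \<subseteq> K \<Longrightarrow> K = J"
    by (rule exists_maximal_in_ideal_family[of ?S]) (use assms in auto)
  then have "maximalideal J R" by (intro maximalidealI) auto
  then show ?thesis using maximal_unique J(1) by blast
qed

lemma Units_iff_notin_M:
  assumes "x \<in> carrier R"
  shows "x \<in> Units R \<longleftrightarrow> x \<notin> M"
proof
  assume "x \<notin> M"
  then have "PIdl x = carrier R"
    using proper_ideal_subset_M[OF cgenideal_ideal[OF assms]] cgenideal_self[OF assms] by blast
  then obtain r where "r \<in> carrier R" "\<one> = r \<otimes> x" using one_closed cgenideal_memE by metis
  then show "x \<in> Units R" using assms m_comm unfolding Units_def by auto
next
  assume "x \<in> Units R"
  then obtain r where "r \<in> carrier R" "r \<otimes> x = \<one>" unfolding Units_def by blast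
  then have "M = carrier R" if "x \<in> M"
    using ideal.I_l_closed[OF M_ideal that] ideal.one_imp_carrier[OF M_ideal] by metis
  then show "x \<notin> M" using maximalideal.I_notcarr[OF maximal] by blast
qed

text \<open>An element outside the radical \<open>M\<close> is a unit and can be cancelled.\<close>

lemma primary_ideal_if_radical_M:
  assumes "ideal Q R" "ideal_radical R Q = M"
  shows "primary_ideal R Q"
  unfolding primary_ideal_def
proof (intro conjI ballI impI)
  show "Q \<noteq> carrier R"
  proof
    assume "Q = carrier R"
    then have "ideal_radical R Q = carrier R"
      unfolding ideal_radical_def by (auto intro: exI[of _ "0::nat"])
    then show False using assms(2) maximalideal.I_notcarr[OF maximal] by simp
  qed
  fix a b assume ab: "a \<in> carrier R" "b \<in> carrier R" "a \<otimes> b \<in> Q"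
  show "a \<in> Q \<or> b \<in> ideal_radical R Q"
  proof (cases "b \<in> M")
    case False
    then have b: "b \<in> Units R" using Units_iff_notin_M ab by blast
    then have "a = inv b \<otimes> (a \<otimes> b)" using ab(1,2) by (simp add: m_lcomm)
    then have "a \<in> Q" using ideal.I_l_closed[OF assms(1) ab(3) Units_inv_closed[OF b]] by simp
    then show ?thesis ..
  qed (simp add: assms(2))
qed (rule assms(1))

lemma ideals_product_M:
  "set Ps \<subseteq> {M} \<Longrightarrow> ideals_product Ps = ideal_power R M (length Ps)"
proof (induction Ps)
  case Nil
  then show ?case by (simp only: ideal_power_0 foldr.simps id_apply list.size)
next
  case (Cons P Ps)
  then have "ideals_product (P # Ps) = M \<cdot> ideal_power R M (length Ps)" by simp
  then show ?case
    using ideal_prod_commute[OF M_ideal ideal_power_ideal[OF M_ideal]] by (simp only: ideal_power_Suc list.size add_Suc_right add_0_right)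
qed

text \<open>\<open>I\<close> contains a product of primes lying over \<open>I\<close>; all of them
  are \<open>M\<close>, so the product is a power of \<open>M\<close>.\<close>

lemma M_power_subset:
  assumes "ideal I R" "\<And>P. primeideal P R \<Longrightarrow> I \<subseteq> P \<Longrightarrow> P = M"
  obtains k where "ideal_power R M k \<subseteq> I"
proof -
  obtain Ps where Ps: "\<forall>P\<in>set Ps. primeideal P R \<and> I \<subseteq> P" "ideals_product Ps \<subseteq> I"
    using ideal_contains_prime_product[OF noetherian_ring_axioms assms(1)] by blast
  then have "set Ps \<subseteq> {M}" using assms(2) by blast
  then show ?thesis using that Ps(2) ideals_product_M by metis
qed

lemma prime_subset_M:
  assumes "primeideal P R"
  shows "P \<subseteq> M"
  using proper_ideal_subset_M[OF primeideal.axioms(1)[OF assms]] primeideal.I_notcarr[OF assms] by blast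

lemma prime_containing_eq_M:
  assumes "ideal_radical R I = M" "primeideal P R" "I \<subseteq> P"
  shows "P = M"
  using ideal_radical_subset_prime[OF assms(2,3)] prime_subset_M[OF assms(2)] assms(1) by blast

lemma radical_eq_M:
  assumes "ideal I R" "I \<subseteq> M" "\<And>P. primeideal P R \<Longrightarrow> I \<subseteq> P \<Longrightarrow> P = M"
  shows "ideal_radical R I = M"
proof
  show "ideal_radical R I \<subseteq> M" using ideal_radical_subset_prime[OF M_prime assms(2)] .
  obtain k where k: "ideal_power R M k \<subseteq> I" using M_power_subset[OF assms(1,3)] by blast
  show "M \<subseteq> ideal_radical R I"
    using pow_in_ideal_power[OF M_ideal, of _ k] k ideal.Icarr[OF M_ideal] ideal_radicalI by blast
qed

section \<open>Goto numbers and parameter ideals in dimension one\<close>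

text \<open>Shows that the \<open>GREATEST\<close> in the definition is attained: exponent
  \<open>0\<close> qualifies, and once the \<open>k\<close>-th power of \<open>M\<close> lies in
  \<open>Q\<close>, an exponent above \<open>k\<close> would put \<open>\<one>\<close> into the
  integral closure of the proper ideal \<open>Q\<close>.\<close>

lemma goto_number:
  assumes "parameter_ideal R M Q"
  shows "ideal_colon R Q (ideal_power R M (goto_number R M Q)) \<subseteq> ideal_integral_closure R Q" (is ?A)
    and "ideal_colon R Q (ideal_power R M g) \<subseteq> ideal_integral_closure R Q \<Longrightarrow> g \<le> goto_number R M Q"
proof -
  let ?P = "\<lambda>g. ideal_colon R Q (ideal_power R M g) \<subseteq> ideal_integral_closure R Q"
  have Q: "ideal Q R" "Q \<noteq> carrier R" "ideal_radical R Q = M"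
    using assms unfolding parameter_ideal_def primary_ideal_def by auto
  obtain k where k: "ideal_power R M k \<subseteq> Q"
    using M_power_subset[OF Q(1) prime_containing_eq_M[OF Q(3)]] by blast
  have bound: "g \<le> k" if "?P g" for g
  proof (rule ccontr)
    assume "\<not> g \<le> k"
    then have sub: "ideal_power R M g \<subseteq> Q"
      using ideal_power_antimono[OF M_ideal, of k g] k by simp
    then have "\<one> \<in> ideal_colon R Q (ideal_power R M g)"
      unfolding ideal_colon_def using ideal.Icarr[OF Q(1)] by auto
    then show False using that one_in_integral_closure[OF Q(1)] Q(2) by blast
  qed
  \<comment> \<open>The zeroth power of \<open>M\<close> contains \<open>\<one>\<close>, which
    forces the elements of the colon ideal into \<open>Q\<close>.\<close>
  have "ideal_colon R Q (ideal_power R M 0) \<subseteq> Q"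
    unfolding ideal_colon_def ideal_power_0 using r_one one_closed by (metis (no_types, lifting) mem_Collect_eq subsetI)
  then have 0: "?P 0" using subset_integral_closure[OF Q(1)] by blast
  show ?A unfolding goto_number_def using GreatestI_nat[of ?P 0 k] 0 bound by blast
  show "g \<le> goto_number R M Q" if "?P g"
    unfolding goto_number_def using Greatest_le_nat[of ?P g k] that bound by blast
qed

lemma parameter_idealI:
  assumes "krull_dim R = 1" "x \<in> carrier R" "ideal_radical R (PIdl x) = M"
  shows "parameter_ideal R M (PIdl x)"
  unfolding parameter_ideal_def
proof (intro conjI exI[of _ "[x]"])
  show "primary_ideal R (PIdl x)"
    using primary_ideal_if_radical_M[OF cgenideal_ideal[OF assms(2)] assms(3)] .
qed (simp_all add: assms(2,3) cgenideal_eq_genideal[OF assms(2), symmetric] assms(1) enat_1_iff(1))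

lemma parameter_idealE:
  assumes "krull_dim R = 1" "parameter_ideal R M Q"
  obtains x where "x \<in> carrier R" "Q = PIdl x" "ideal_radical R Q = M"
proof -
  obtain xs where xs: "set xs \<subseteq> carrier R" "length xs = 1" "Q = Idl (set xs)"
    using assms unfolding parameter_ideal_def by (metis enat_1_iff(1))
  then obtain x where "xs = [x]" by (auto simp: length_Suc_conv)
  then show ?thesis
    using that[of x] xs cgenideal_eq_genideal assms(2) unfolding parameter_ideal_def by auto
qed

text \<open>The zero ideal contains a product of primes \<open>Ps\<close>. In dimension one those
  different from \<open>M\<close> are pairwise incomparable, so some \<open>x\<close> in
  \<open>M\<close> avoids them all, and then \<open>M\<close> is the only prime over
  \<open>PIdl x\<close>.\<close>

lemma exists_parameter_ideal:
  assumes dim: "krull_dim R = 1"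
  shows "\<exists>Q. parameter_ideal R M Q"
proof -
  obtain Ps where Ps: "\<forall>P\<in>set Ps. primeideal P R" "ideals_product Ps \<subseteq> {\<zero>}"
    using ideal_contains_prime_product[OF noetherian_ring_axioms zeroideal] by blast
  let ?F = "set Ps - {M}"
  have psub: "P \<subset> M" if "primeideal P R" "P \<noteq> M" for P using prime_subset_M that by blast
  have incomp: "P = Q" if "primeideal P R" "primeideal Q R" "Q \<noteq> M" "P \<subseteq> Q" for P Q
    using no_prime_chain_2[OF dim that(1,2) M_prime _ psub[OF that(2,3)]] that(4) by blast
  have "\<exists>x\<in>M. \<forall>P\<in>?F. x \<notin> P"
  proof (rule prime_avoidance_incomparable[OF M_ideal])
    show "\<forall>P\<in>?F. primeideal P R \<and> \<not> M \<subseteq> P" using Ps(1) psub by blast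
    show "\<forall>P\<in>?F. \<forall>Q\<in>?F. P \<subseteq> Q \<longrightarrow> P = Q" using Ps(1) incomp by blast
  qed simp
  then obtain x where x: "x \<in> M" "\<forall>P\<in>?F. x \<notin> P" by blast
  have xc: "x \<in> carrier R" using x ideal.Icarr[OF M_ideal] by blast
  have "P = M" if P: "primeideal P R" "PIdl x \<subseteq> P" for P
  proof (rule ccontr)
    assume "P \<noteq> M"
    have "ideals_product Ps \<subseteq> P"
      using Ps(2) additive_subgroup.zero_closed[OF ideal.axioms(1)[OF primeideal.axioms(1)[OF P(1)]]] by blast
    \<comment> \<open>A prime containing the product contains a factor; as \<open>P\<close> is not
      \<open>M\<close>, the dimension then forces equality with that factor, which \<open>x\<close>
      avoids.\<close>
    then obtain P' where P': "P' \<in> set Ps" "P' \<subseteq> P"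
      using primeideal_contains_factor[OF P(1), of Ps] Ps(1) primeideal.axioms(1) by blast
    then have "P' = P" using incomp[OF _ P(1) \<open>P \<noteq> M\<close>] Ps(1) by blast
    then show False using x(2) P' \<open>P \<noteq> M\<close> P(2) cgenideal_self[OF xc] by blast
  qed
  moreover have "PIdl x \<subseteq> M" using cgenideal_minimal[OF M_ideal x(1)] .
  ultimately have "ideal_radical R (PIdl x) = M"
    by (intro radical_eq_M cgenideal_ideal[OF xc])
  then show ?thesis using parameter_idealI[OF dim xc] by blast
qed

section \<open>Comparison of Goto numbers\<close>

text \<open>A nilpotent \<open>x\<close> lies in every prime, so \<open>M\<close> would be the only
  prime; but dimension one provides two distinct ones.\<close>

lemma parameter_not_nilpotent:
  assumes "krull_dim R = 1" "x \<in> carrier R" "ideal_radical R (PIdl x) = M"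
  shows "x [^] (n :: nat) \<noteq> \<zero>"
proof
  assume "x [^] n = \<zero>"
  have "P = M" if "primeideal P R" for P
  proof -
    interpret P: primeideal P R by fact
    have "x \<in> P"
      using ideal_radical_subset_prime[OF that order_refl] ideal_radicalI[of x n P]
        \<open>x [^] n = \<zero>\<close> assms(2) P.zero_closed by auto
    then show ?thesis
      using prime_containing_eq_M[OF assms(3) that] cgenideal_minimal[OF P.is_ideal] by blast
  qed
  moreover obtain P Q where "primeideal P R" "primeideal Q R" "P \<subset> Q"
    by (rule exists_prime_chain_1[OF assms(1)])
  ultimately show False by blast
qed

text \<open>Minimal primes are bypassed by a case distinction. If \<open>b\<close> is in
  \<open>M\<close>, some power of \<open>b\<close> is a multiple of \<open>z\<close>, so a higher
  power is a multiple of \<open>z^n b = 0\<close>. If \<open>b\<close> is a unit, then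
  \<open>z^n = 0\<close>, and \<open>z \<otimes> y\<close> would be a nilpotent parameter.\<close>

lemma nilpotent_if_annihilated:
  assumes "krull_dim R = 1" "y \<in> carrier R" "z \<in> carrier R" "ideal_radical R (PIdl (z \<otimes> y)) = M"
    and "b \<in> carrier R" "z [^] (n :: nat) \<otimes> b = \<zero>"
  shows "\<exists>k :: nat. b [^] k = \<zero>"
proof (cases "b \<in> M")
  case True
  then have "b \<in> ideal_radical R (PIdl (z \<otimes> y))" using assms(4) by simp
  then obtain j :: nat where "b [^] j \<in> PIdl (z \<otimes> y)" by (rule ideal_radicalE)
  then obtain r where r: "r \<in> carrier R" "b [^] j = r \<otimes> (z \<otimes> y)" by (rule cgenideal_memE)
  then have "b [^] j = z \<otimes> (r \<otimes> y)" using assms by (simp add: m_lcomm)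
  then have "b [^] (j * n) = z [^] n \<otimes> (r \<otimes> y) [^] n"
    using assms r by (simp add: nat_pow_pow[symmetric] nat_pow_distrib)
  \<comment> \<open>The additional factor \<open>b\<close> is the one that \<open>z [^] n\<close>
    annihilates.\<close>
  then have "b [^] Suc (j * n) = (z [^] n \<otimes> b) \<otimes> (r \<otimes> y) [^] n"
    using assms(2,3,5) r(1) by (simp add: m_ac)
  then show ?thesis using assms r(1) by (intro exI[of _ "Suc (j * n)"]) simp
next
  case False
  then have "b \<in> Units R" using Units_iff_notin_M assms by blast
  then have "z [^] n = (z [^] n \<otimes> b) \<otimes> inv b" using assms(3,5) by (simp add: m_assoc)
  also have "\<dots> = \<zero>" using assms(6) \<open>b \<in> Units R\<close> by simp
  finally have "z [^] n = \<zero>" .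
  then have "(z \<otimes> y) [^] n = \<zero>" using assms by (simp add: nat_pow_distrib)
  then show ?thesis using parameter_not_nilpotent[of "z \<otimes> y"] assms by blast
qed

lemma goto_number_mono:
  assumes "krull_dim R = 1" "parameter_ideal R M Q" "parameter_ideal R M Q'" "Q \<subseteq> Q'"
  shows "goto_number R M Q \<le> goto_number R M Q'"
proof (rule goto_number(2)[OF assms(3)], rule subsetI)
  \<comment> \<open>It remains to see that the exponent \<open>?g\<close> of \<open>Q\<close> also
    qualifies for \<open>Q'\<close>.\<close>
  let ?g = "goto_number R M Q"
  obtain x where x: "x \<in> carrier R" "Q = PIdl x" "ideal_radical R Q = M"
    using parameter_idealE[OF assms(1,2)] by blast
  obtain y where y: "y \<in> carrier R" "Q' = PIdl y" using parameter_idealE[OF assms(1,3)] by blast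
  have "x \<in> PIdl y" using assms(4) cgenideal_self[OF x(1)] x(2) y(2) by blast
  then obtain z where z: "z \<in> carrier R" "x = z \<otimes> y" by (rule cgenideal_memE)
  fix a assume "a \<in> ideal_colon R Q' (ideal_power R M ?g)"
  then have a: "a \<in> carrier R" "\<And>w. w \<in> ideal_power R M ?g \<Longrightarrow> a \<otimes> w \<in> PIdl y"
    unfolding ideal_colon_def y by auto
  \<comment> \<open>Multiplication by \<open>z\<close> maps \<open>PIdl y\<close> into
    \<open>PIdl x\<close>, which carries the colon condition from \<open>Q'\<close> to
    \<open>Q\<close>.\<close>
  have "(z \<otimes> a) \<otimes> w \<in> Q" if w: "w \<in> ideal_power R M ?g" for w
  proof -
    obtain r where r: "r \<in> carrier R" "a \<otimes> w = r \<otimes> y" using a(2)[OF w] by (rule cgenideal_memE)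
    have "w \<in> carrier R" using ideal.Icarr[OF ideal_power_ideal[OF M_ideal] w] .
    then have "(z \<otimes> a) \<otimes> w = r \<otimes> x" using r a(1) y(1) z by (simp add: m_assoc m_lcomm)
    then show ?thesis using x(2) cgenideal_memI[OF r(1)] by simp
  qed
  then have "z \<otimes> a \<in> ideal_colon R Q (ideal_power R M ?g)"
    unfolding ideal_colon_def using z(1) a(1) by auto
  then have "z \<otimes> a \<in> ideal_integral_closure R Q" using goto_number(1)[OF assms(2)] by blast
  then obtain n where n: "n > 0" "\<zero> \<in> monic_values R (PIdl (z \<otimes> y)) (z \<otimes> a) n"
    using integral_closure_iff[OF cgenideal_ideal[OF x(1)], of "z \<otimes> a"] z a(1) x(2) by auto
  then obtain b where b: "b \<in> monic_values R (PIdl y) a n" "\<zero> = z [^] n \<otimes> b"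
    using monic_values_scale[OF y(1) z(1) a(1)] by blast
  have "b \<in> carrier R" using monic_values_carrier[OF cgenideal_ideal[OF y(1)] a(1) b(1)] .
  then obtain k :: nat where "b [^] k = \<zero>"
    using nilpotent_if_annihilated[OF assms(1) y(1) z(1), of b n] x(2,3) z(2) b(2) by auto
  then show "a \<in> ideal_integral_closure R Q'"
    unfolding y(2) using integral_closureI_nilpotent[OF cgenideal_ideal[OF y(1)] a(1) n(1) b(1)] by blast
qed

end

theorem theorem3p1:
  fixes R :: "('a, 'b) ring_scheme" (structure) and M :: "'a set"
  assumes "noetherian_local_ring R M"
    and "krull_dim R = 1"
  shows "(\<forall>y \<in> carrier R. parameter_ideal R M (PIdl y) \<longrightarrow>
            (\<forall>Q. parameter_ideal R M Q \<and> Q \<subseteq> PIdl y \<longrightarrow>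
              goto_number R M Q \<le> goto_number R M (PIdl y)))
       \<and> (\<exists>n > 0. \<exists>g.
            (\<forall>Q. parameter_ideal R M Q \<and> Q \<subseteq> ideal_power R M n \<longrightarrow> goto_number R M Q = g) \<and>
            (\<exists>Q. parameter_ideal R M Q \<and> goto_number R M Q = g) \<and>
            (\<forall>Q. parameter_ideal R M Q \<longrightarrow> g \<le> goto_number R M Q))"
proof -
  interpret noetherian_local_ring R M by fact
  \<comment> \<open>Goto numbers are natural numbers, so their minimum is attained as soon as some
    parameter ideal exists.\<close>
  obtain Q0 where Q0: "parameter_ideal R M Q0"
    and min: "\<And>Q. parameter_ideal R M Q \<Longrightarrow> goto_number R M Q0 \<le> goto_number R M Q"
    using exists_parameter_ideal[OF assms(2)] ex_has_least_nat[of "parameter_ideal R M" _ "goto_number R M"]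
    by blast
  obtain y where y: "y \<in> carrier R" "Q0 = PIdl y" "ideal_radical R Q0 = M"
    using parameter_idealE[OF assms(2) Q0] by blast
  have "ideal Q0 R" using cgenideal_ideal[OF y(1)] y(2) by simp
  then obtain k where k: "ideal_power R M k \<subseteq> Q0"
    using M_power_subset prime_containing_eq_M[OF y(3)] by blast
  \<comment> \<open>Passing to \<open>Suc k\<close> yields a positive exponent without a separate
    argument about \<open>k\<close>.\<close>
  have "ideal_power R M (Suc k) \<subseteq> Q0" using ideal_power_Suc_subset(1)[OF M_ideal] k by blast
  \<comment> \<open>Monotonicity gives one inequality and minimality of \<open>Q0\<close> the
    other.\<close>
  then have "goto_number R M Q = goto_number R M Q0"
    if "parameter_ideal R M Q" "Q \<subseteq> ideal_power R M (Suc k)" for Q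
    using goto_number_mono[OF assms(2) that(1) Q0] that(2) min[OF that(1)] by (meson order_antisym subset_trans)
  then have "\<exists>n > 0. \<exists>g.
            (\<forall>Q. parameter_ideal R M Q \<and> Q \<subseteq> ideal_power R M n \<longrightarrow> goto_number R M Q = g) \<and>
            (\<exists>Q. parameter_ideal R M Q \<and> goto_number R M Q = g) \<and>
            (\<forall>Q. parameter_ideal R M Q \<longrightarrow> g \<le> goto_number R M Q)"
    using Q0 min by (intro exI[of _ "Suc k"] conjI exI[of _ "goto_number R M Q0"]) auto
  then show ?thesis using goto_number_mono[OF assms(2)] by blast
qed

end
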